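(* Let $X$ be a Banach space containing an isomorphic copy of $c_0$. Then there exists a nonempty, bounded, closed, and convex subset $K\subset X$ such that, for any increasing sequence $(\alpha_n)_{n\ge1}\subset(0,1]$ with $\alpha_n\to1$, there exists a fixed-point-free asymptotically $(\alpha_n)$-Hölder nonexpansive mapping $T\colon K\to K$.
   Context: Let $K$ be a nonempty subset of a Banach space $X$ and let $(\alpha_n)\subset(0,1]$ satisfy $\alpha_n\to1$. A mapping $T\colon K\to K$ is asymptotically $(\alpha_n)$-Hölder nonexpansive if there exists a sequence $(\varepsilon_n)\subset[0,\infty)$ with $\varepsilon_n\to0$ such that $\|T^n x-T^n y\|\le(1+\varepsilon_n)\|x-y\|^{\alpha_n}$ for all $x,y\in K$ and $n\ge1$, where $T^n$ is the $n$-th iterate of $T$. Fixed-point-free means that there is no $x\in K$ with $Tx=x$. *)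

theory Defs
  imports "HOL-Analysis.Analysis"
begin

text \<open>The Banach space $c_0$ of real null sequences. Since \<^typ>\<open>nat\<close> is discrete,
  \<^typ>\<open>nat \<Rightarrow>\<^sub>C real\<close> consists of all bounded real sequences with the supremum norm; $c_0$ is its
  closed subspace of sequences converging to zero, with the restricted operations and norm.\<close>

typedef c0 = "{x :: nat \<Rightarrow>\<^sub>C real. apply_bcontfun x \<longlonglongrightarrow> 0}"
  morphisms c0_seq Abs_c0
  by (rule exI[of _ 0]) simp

setup_lifting type_definition_c0

lemma c0_seq_tendsto: "apply_bcontfun (c0_seq x) \<longlonglongrightarrow> 0"
  using c0_seq[of x] by simp

instantiation c0 :: real_vector
begin

lift_definition zero_c0 :: c0 is 0
  by simp

lift_definition plus_c0 :: "c0 \<Rightarrow> c0 \<Rightarrow> c0" is "(+)"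
  by (simp add: tendsto_add_zero)

lift_definition minus_c0 :: "c0 \<Rightarrow> c0 \<Rightarrow> c0" is "(-)"
  using tendsto_diff by fastforce

lift_definition uminus_c0 :: "c0 \<Rightarrow> c0" is uminus
  using tendsto_minus by fastforce

lift_definition scaleR_c0 :: "real \<Rightarrow> c0 \<Rightarrow> c0" is scaleR
  by (simp add: tendsto_mult_right_zero)

instance
proof
  fix x y z :: c0 and a b :: real
  show "x + y + z = x + (y + z)" by transfer (rule add.assoc)
  show "x + y = y + x" by transfer (rule add.commute)
  show "0 + x = x" by transfer simp
  show "- x + x = 0" by transfer simp
  show "x - y = x + - y" by transfer simp
  show "a *\<^sub>R (x + y) = a *\<^sub>R x + a *\<^sub>R y" by transfer (rule scaleR_add_right)
  show "(a + b) *\<^sub>R x = a *\<^sub>R x + b *\<^sub>R x" by transfer (rule scaleR_add_left)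
  show "a *\<^sub>R b *\<^sub>R x = (a * b) *\<^sub>R x" by transfer simp
  show "1 *\<^sub>R x = x" by transfer simp
qed

end

instantiation c0 :: real_normed_vector
begin

lift_definition norm_c0 :: "c0 \<Rightarrow> real" is norm .

lift_definition dist_c0 :: "c0 \<Rightarrow> c0 \<Rightarrow> real" is dist .

definition sgn_c0 :: "c0 \<Rightarrow> c0"
  where "sgn_c0 x = x /\<^sub>R norm x"

definition uniformity_c0 :: "(c0 \<times> c0) filter"
  where "uniformity_c0 = (INF e\<in>{0 <..}. principal {(x, y). dist x y < e})"

definition open_c0 :: "c0 set \<Rightarrow> bool"
  where "open_c0 U = (\<forall>x\<in>U. \<forall>\<^sub>F (x', y) in uniformity. x' = x \<longrightarrow> y \<in> U)"

instance
proof
  fix x y :: c0 and a :: real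
  show "dist x y = norm (x - y)" by transfer (rule dist_norm)
  show "(norm x = 0) = (x = 0)" by transfer simp
  show "norm (x + y) \<le> norm x + norm y" by transfer (rule norm_triangle_ineq)
  show "norm (a *\<^sub>R x) = \<bar>a\<bar> * norm x" by transfer simp
qed (rule sgn_c0_def uniformity_c0_def open_c0_def)+

end

instance c0 :: banach
proof
  fix X :: "nat \<Rightarrow> c0"
  assume "Cauchy X"
  have "uniformly_Cauchy_on UNIV (\<lambda>n. apply_bcontfun (c0_seq (X n)))"
    unfolding uniformly_Cauchy_on_def
  proof (intro allI impI)
    fix e :: real
    assume "e > 0"
    with \<open>Cauchy X\<close> obtain M where M: "\<And>m n. m \<ge> M \<Longrightarrow> n \<ge> M \<Longrightarrow> dist (X m) (X n) < e"
      unfolding Cauchy_def by blast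
    have "dist (c0_seq (X m) i) (c0_seq (X n) i) < e" if "m \<ge> M" "n \<ge> M" for m n i
      using M[OF that] unfolding dist_c0.rep_eq by (rule dist_fun_lt_imp_dist_val_lt)
    then show "\<exists>M. \<forall>i\<in>UNIV. \<forall>m\<ge>M. \<forall>n\<ge>M. dist (c0_seq (X m) i) (c0_seq (X n) i) < e"
      by blast
  qed
  then have "uniformly_convergent_on UNIV (\<lambda>n. apply_bcontfun (c0_seq (X n)))"
    by (rule Cauchy_uniformly_convergent)
  then obtain g where "uniform_limit UNIV (\<lambda>n. apply_bcontfun (c0_seq (X n))) g sequentially"
    by (auto simp: uniformly_convergent_on_def)
  from uniform_limit_bcontfunE[OF this sequentially_bot]
  obtain l where l: "(\<lambda>n. c0_seq (X n)) \<longlonglongrightarrow> l"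
    by blast
  have "apply_bcontfun l \<longlonglongrightarrow> 0"
  proof (rule swap_uniform_limit')
    show "\<forall>\<^sub>F n in sequentially. apply_bcontfun (c0_seq (X n)) \<longlonglongrightarrow> 0"
      by (simp add: c0_seq_tendsto)
    show "(\<lambda>n. 0 :: real) \<longlonglongrightarrow> 0"
      by (rule tendsto_const)
    show "uniform_limit UNIV (\<lambda>n. apply_bcontfun (c0_seq (X n))) (apply_bcontfun l) sequentially"
      using l by (rule tendsto_bcontfun_uniform_limit)
    show "\<forall>\<^sub>F i in sequentially. i \<in> (UNIV :: nat set)"
      by simp
  qed simp
  then have "c0_seq (Abs_c0 l) = l"
    by (simp add: Abs_c0_inverse)
  then have "(\<lambda>n. dist (X n) (Abs_c0 l)) \<longlonglongrightarrow> 0"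
    using l tendsto_dist_iff[of "\<lambda>n. c0_seq (X n)" l] unfolding dist_c0.rep_eq by simp
  then have "X \<longlonglongrightarrow> Abs_c0 l"
    by (rule tendsto_dist_iff[THEN iffD2])
  then show "convergent X"
    by (rule convergentI)
qed

lemma norm_c0_eq_SUP: "norm x = (SUP n. \<bar>apply_bcontfun (c0_seq x) n\<bar>)"
  by (simp add: norm_c0.rep_eq norm_bcontfun_def dist_bcontfun.rep_eq)

definition contains_isomorphic_copy_of_c0 :: "'a::real_normed_vector itself \<Rightarrow> bool"
  where "contains_isomorphic_copy_of_c0 _ \<longleftrightarrow>
    (\<exists>(Y :: 'a set) (J :: c0 \<Rightarrow> 'a) J'. subspace Y \<and> linear J \<and> homeomorphism UNIV Y J J')"

definition asymptotically_Holder_nonexpansive ::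
    "(nat \<Rightarrow> real) \<Rightarrow> 'a::real_normed_vector set \<Rightarrow> ('a \<Rightarrow> 'a) \<Rightarrow> bool"
  where "asymptotically_Holder_nonexpansive \<alpha> K T \<longleftrightarrow>
    T \<in> K \<rightarrow> K \<and>
    (\<exists>\<epsilon> :: nat \<Rightarrow> real. (\<forall>n\<ge>1. 0 \<le> \<epsilon> n) \<and> \<epsilon> \<longlonglongrightarrow> 0 \<and>
      (\<forall>x\<in>K. \<forall>y\<in>K. \<forall>n\<ge>1.
        norm ((T ^^ n) x - (T ^^ n) y) \<le> (1 + \<epsilon> n) * norm (x - y) powr \<alpha> n))"

definition fixed_point_free_on :: "'a set \<Rightarrow> ('a \<Rightarrow> 'a) \<Rightarrow> bool"
  where "fixed_point_free_on K T \<longleftrightarrow> \<not> (\<exists>x\<in>K. T x = x)"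

end

theory Submission
  imports Defs
begin

text \<open>Every space containing $c_0$ carries a fixed-point-free map whose iterates have Lipschitz
  constants tending to $1$ on a suitable bounded, closed, convex set. Since the set is bounded, such
  a map is asymptotically Hoelder nonexpansive for every sequence of exponents tending to $1$ from
  below (\<open>asymptotically_Holder_nonexpansiveI\<close>), so one set and one map serve all exponents.

  The map is the affine shift $(x_0, x_1, \ldots) \mapsto (1, x_0, x_1, \ldots)$ on the null sequences
  with values in $[0,1]$, transported by an embedding $S$ of $c_0$. The iterate of order $n$ moves
  differences into the tail from index $n$ on, so its Lipschitz constant is controlled as soon as
  $\|d\|_\infty \le \|S d\|$ for all $d$, and $\|S d\| \le \beta_n \|d\|_\infty$ for all $d$
  vanishing before $n$, where $\beta_n \to 1$ (\<open>shift_on_embedded_cube\<close>).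

  An arbitrary embedding $J$ is improved to such an $S$ by a variant of James' distortion argument
  (\<open>block_embedding\<close>). Let $\rho$ be the limit, as $k \to \infty$, of the supremum of $\|J t\|$ over
  the unit ball of the tail from $k$ on. The upper estimates with asymptotic constant $\rho$ are then
  automatic for block sequences. For the lower estimates, each new block must keep norm
  at least $\rho$, up to a small defect, after the addition of any vector of norm at most $2$ on the
  earlier coordinates and of any vector of the unit ball of the later tail. James' averaging argument
  takes care of the later tail. For the earlier coordinates, let $R(v)$ be the limit of the suprema
  of $\|v + J t\|$ over the tail balls. By symmetry $R(v) \ge R(0) = \rho$
  (\<open>tail_limit_zero_le\<close>), so for each $v$ there are blocks $t$ arbitrarily far out with
  $\|v + J t\|$ not much below $\rho$; adding disjoint blocks of this kind handles a finite net of
  vectors $v$ at once (\<open>asymptotically_extremal_block\<close>). Finally, weights decreasing to $1/\rho$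
  compensate the small defects of the blocks.\<close>

section \<open>Coordinates in $c_0$\<close>

abbreviation coord :: "c0 \<Rightarrow> nat \<Rightarrow> real"
  where "coord x n \<equiv> apply_bcontfun (c0_seq x) n"

lemma coord_add [simp]: "coord (x + y) n = coord x n + coord y n"
  by (simp add: plus_c0.rep_eq)

lemma coord_diff [simp]: "coord (x - y) n = coord x n - coord y n"
  by (simp add: minus_c0.rep_eq)

lemma coord_uminus [simp]: "coord (- x) n = - coord x n"
  by (simp add: uminus_c0.rep_eq)

lemma coord_scaleR [simp]: "coord (a *\<^sub>R x) n = a * coord x n"
  by (simp add: scaleR_c0.rep_eq)

lemma coord_zero [simp]: "coord 0 n = 0"
  by (simp add: zero_c0.rep_eq)

lemma c0_eqI: "(\<And>n. coord x n = coord y n) \<Longrightarrow> x = y"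
  by (metis bcontfun_eqI c0_seq_inject)

lemma abs_coord_le_norm: "\<bar>coord x n\<bar> \<le> norm x"
  using norm_bounded[of "c0_seq x" n] by (simp add: norm_c0.rep_eq)

lemma norm_c0_leI: "(\<And>n. \<bar>coord x n\<bar> \<le> M) \<Longrightarrow> norm x \<le> M"
  unfolding norm_c0.rep_eq by (rule norm_bound) simp

text \<open>The element of $c_0$ with a given null sequence of coordinates; the value is unspecified when
  the sequence does not tend to $0$.\<close>
definition c0_of :: "(nat \<Rightarrow> real) \<Rightarrow> c0"
  where "c0_of f = Abs_c0 (Bcontfun f)"

lemma coord_c0_of [simp]:
  assumes "f \<longlonglongrightarrow> 0"
  shows "coord (c0_of f) n = f n"
proof -
  have "bounded (range f)"
    using assms convergent_imp_bounded by blast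
  then have "f \<in> bcontfun"
    by (auto simp: bcontfun_def continuous_on_discrete)
  then have b: "apply_bcontfun (Bcontfun f) = f"
    by (simp add: Bcontfun_inverse)
  then show ?thesis
    using assms by (simp add: c0_of_def Abs_c0_inverse b)
qed

text \<open>The $k$-th standard unit vector.\<close>
definition c0_unit :: "nat \<Rightarrow> c0"
  where "c0_unit k = c0_of (\<lambda>n. if n = k then 1 else 0)"

lemma coord_c0_unit [simp]: "coord (c0_unit k) n = (if n = k then 1 else 0)"
proof -
  have "(\<lambda>n. if n = k then 1 else 0 :: real) \<longlonglongrightarrow> 0"
    by (rule tendsto_eventually) (rule eventually_sequentiallyI[of "Suc k"], simp)
  then show ?thesis by (simp add: c0_unit_def)
qed

text \<open>The coordinate projection onto an index set $I$.\<close>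
definition c0_restrict :: "nat set \<Rightarrow> c0 \<Rightarrow> c0"
  where "c0_restrict I x = c0_of (\<lambda>n. if n \<in> I then coord x n else 0)"

lemma coord_c0_restrict [simp]: "coord (c0_restrict I x) n = (if n \<in> I then coord x n else 0)"
proof -
  have "(\<lambda>n. if n \<in> I then coord x n else 0) \<longlonglongrightarrow> 0"
    by (rule Lim_null_comparison[OF _ tendsto_rabs_zero[OF c0_seq_tendsto[of x]]]) simp
  then show ?thesis by (simp add: c0_restrict_def)
qed

lemma norm_c0_attained: obtains i where "norm x = \<bar>coord x i\<bar>"
proof (cases "x = 0")
  case True
  then show ?thesis using that[of 0] by simp
next
  case False
  then have pos: "norm x / 2 > 0" by simp
  then obtain N where N: "\<And>n. n \<ge> N \<Longrightarrow> \<bar>coord x n\<bar> < norm x / 2"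
    using LIMSEQ_D[OF c0_seq_tendsto[of x] pos] unfolding diff_zero real_norm_def by blast
  define M where "M = Max (insert (norm x / 2) ((\<lambda>n. \<bar>coord x n\<bar>) ` {..<N}))"
  have le: "\<bar>coord x n\<bar> \<le> M" for n
  proof (cases "n < N")
    case True
    then show ?thesis unfolding M_def by (intro Max_ge) auto
  next
    case False
    have "norm x / 2 \<le> M" unfolding M_def by (intro Max_ge) auto
    then show ?thesis using N[of n] False by linarith
  qed
  then have nM: "norm x \<le> M" by (rule norm_c0_leI)
  have "M \<in> insert (norm x / 2) ((\<lambda>n. \<bar>coord x n\<bar>) ` {..<N})"
    unfolding M_def by (intro Max_in) auto
  moreover have "M \<noteq> norm x / 2" using nM pos by linarith
  ultimately obtain i where "M = \<bar>coord x i\<bar>" by auto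
  then show ?thesis using nM abs_coord_le_norm[of x i] that[of i] by linarith
qed

section \<open>Isomorphic copies of $c_0$\<close>

text \<open>A quantitative form of continuity at $0$ by scaling; it is applied with one of the two maps the
  identity, once for an embedding and once for its inverse.\<close>
lemma homogeneous_bound:
  fixes f :: "'a::real_normed_vector \<Rightarrow> 'b::real_normed_vector"
    and g :: "'a::real_normed_vector \<Rightarrow> 'c::real_normed_vector"
  assumes f: "linear f" and g: "linear g" and d: "d > 0"
    and b: "\<And>x. norm (f x) < d \<Longrightarrow> norm (g x) \<le> 1"
  shows "d * norm (g x) \<le> norm (f x)"
proof (rule ccontr)
  assume "\<not> ?thesis"
  then have less: "norm (f x) < d * norm (g x)" by simp
  obtain c where c: "norm (f x) / d < c" "c < norm (g x)"
    using less d dense[of "norm (f x) / d" "norm (g x)"] by (auto simp: field_simps)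
  have "norm (f x) / d \<ge> 0" using d by simp
  then have cpos: "c > 0" using c(1) by linarith
  have "norm (f ((1 / c) *\<^sub>R x)) < d"
    using c cpos d by (simp add: linear_scale[OF f] field_simps)
  then have "norm (g ((1 / c) *\<^sub>R x)) \<le> 1" by (rule b)
  then show False
    using c cpos by (simp add: linear_scale[OF g] field_simps)
qed

lemma c0_copy_bounds:
  assumes "contains_isomorphic_copy_of_c0 TYPE('a::real_normed_vector)"
  obtains J :: "c0 \<Rightarrow> 'a::real_normed_vector" and A
  where "bounded_linear J" "A > 0" "\<And>x. A * norm x \<le> norm (J x)"
proof -
  obtain Y :: "'a set" and J :: "c0 \<Rightarrow> 'a" and J' where Y: "subspace Y" and J: "linear J"
    and h: "homeomorphism UNIV Y J J'"
    using assms unfolding contains_isomorphic_copy_of_c0_def by blast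
  have J0: "J 0 = 0" using J by (rule linear_0)
  have inv: "J' (J x) = x" for x using h by (simp add: homeomorphism_def)
  have "continuous_on UNIV J" "continuous_on Y J'" "J ` UNIV = Y"
    using h by (auto simp: homeomorphism_def)
  have "\<exists>d>0. \<forall>x. norm x < d \<longrightarrow> norm (J x) < 1"
    using \<open>continuous_on UNIV J\<close>[unfolded continuous_on_iff, rule_format, of 0 1] J0
    by (simp add: dist_norm)
  then obtain d where d: "d > 0" "\<And>x. norm x < d \<Longrightarrow> norm (J x) < 1" by blast
  have "d * norm (J x) \<le> norm x" for x
    by (rule homogeneous_bound[OF linear_ident J d(1)]) (rule less_imp_le[OF d(2)])
  then have "norm (J x) \<le> norm x * (1 / d)" for x
    using d(1) by (simp add: field_simps)
  with J have bl: "bounded_linear J"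
    by (intro bounded_linear.intro bounded_linear_axioms.intro exI[of _ "1 / d"]) auto
  have "0 \<in> Y" using Y subspace_0 by blast
  moreover have "J' 0 = 0" using inv[of 0] J0 by simp
  ultimately have "\<exists>e>0. \<forall>y\<in>Y. norm y < e \<longrightarrow> norm (J' y) < 1"
    using \<open>continuous_on Y J'\<close>[unfolded continuous_on_iff, rule_format, of 0 1]
    by (simp add: dist_norm)
  then obtain e where e: "e > 0" "\<And>y. y \<in> Y \<Longrightarrow> norm y < e \<Longrightarrow> norm (J' y) < 1" by blast
  have "norm x \<le> 1" if "norm (J x) < e" for x
  proof -
    have "J x \<in> Y" using \<open>J ` UNIV = Y\<close> by blast
    then show ?thesis using e(2)[of "J x"] that inv by simp
  qed
  then have "e * norm x \<le> norm (J x)" for x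
    using homogeneous_bound[OF J linear_ident e(1)] by blast
  with bl e(1) show thesis by (rule that)
qed

section \<open>Tails and blocks\<close>

text \<open>The sequence \<open>x\<close> vanishes outside \<open>I\<close>.\<close>
definition supp_in :: "nat set \<Rightarrow> c0 \<Rightarrow> bool"
  where "supp_in I x \<longleftrightarrow> (\<forall>n. n \<notin> I \<longrightarrow> coord x n = 0)"

text \<open>The unit ball of the sequences that vanish before index \<open>k\<close>.\<close>
definition tail_ball :: "nat \<Rightarrow> c0 set"
  where "tail_ball k = {x. supp_in {k..} x \<and> norm x \<le> 1}"

lemma finite_block_compact: "\<exists>C. compact C \<and> {v. supp_in {..<p} v \<and> norm v \<le> M} \<subseteq> C"
proof (induction p)
  case 0
  have "{v. supp_in {..<0} v \<and> norm v \<le> M} \<subseteq> {0}"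
  proof
    fix v assume "v \<in> {v. supp_in {..<0} v \<and> norm v \<le> M}"
    then have "coord v n = coord 0 n" for n by (simp add: supp_in_def)
    then show "v \<in> {0}" using c0_eqI by blast
  qed
  then have "compact {0::c0} \<and> {v. supp_in {..<0} v \<and> norm v \<le> M} \<subseteq> {0}" by simp
  then show ?case ..
next
  case (Suc p)
  then obtain C where C: "compact C" "{v. supp_in {..<p} v \<and> norm v \<le> M} \<subseteq> C" by blast
  define D where "D = {x + y |x y. x \<in> C \<and> y \<in> (\<lambda>c. c *\<^sub>R c0_unit p) ` {-M..M}}"
  have "compact ((\<lambda>c. c *\<^sub>R c0_unit p) ` {-M..M})"
    by (intro compact_continuous_image continuous_on_scaleR continuous_on_id continuous_on_const)
      simp
  then have "compact D" unfolding D_def by (rule compact_sums[OF C(1)])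
  moreover have "v \<in> D" if v: "supp_in {..<Suc p} v" "norm v \<le> M" for v
  proof -
    have "\<bar>coord v p\<bar> \<le> M" using abs_coord_le_norm[of v p] v(2) by linarith
    then have "coord v p \<in> {-M..M}" by (simp add: abs_le_iff)
    then have m: "coord v p *\<^sub>R c0_unit p \<in> (\<lambda>c. c *\<^sub>R c0_unit p) ` {-M..M}" by (rule imageI)
    \<comment> \<open>split off the last coordinate, which ranges over a compact segment\<close>
    let ?x = "v - coord v p *\<^sub>R c0_unit p"
    have "supp_in {..<p} ?x" using v(1) by (auto simp: supp_in_def)
    moreover have "norm ?x \<le> M"
    proof (rule norm_c0_leI)
      fix n show "\<bar>coord ?x n\<bar> \<le> M"
        using abs_coord_le_norm[of v n] abs_coord_le_norm[of v 0] v(2) by auto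
    qed
    ultimately have "?x \<in> C" using C(2) by blast
    with m have "?x + coord v p *\<^sub>R c0_unit p \<in> D" unfolding D_def by blast
    then show ?thesis by simp
  qed
  ultimately have "compact D \<and> {v. supp_in {..<Suc p} v \<and> norm v \<le> M} \<subseteq> D" by auto
  then show ?case ..
qed

lemma tail_ball_truncate:
  assumes t: "t \<in> tail_ball k" and e: "e > 0"
  obtains m x where "m > k" "supp_in {k..<m} x" "norm x \<le> 1" "norm (t - x) \<le> e"
proof -
  obtain N where N: "\<And>n. n \<ge> N \<Longrightarrow> \<bar>coord t n\<bar> < e"
    using LIMSEQ_D[OF c0_seq_tendsto[of t] e] unfolding diff_zero real_norm_def by blast
  define m where "m = max N (Suc k)"
  define x where "x = c0_restrict {..<m} t"
  have x: "coord x n = (if n < m then coord t n else 0)" for n by (simp add: x_def)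
  show thesis
  proof (rule that[of m x])
    show "m > k" by (simp add: m_def)
    show "supp_in {k..<m} x" using t by (auto simp: supp_in_def x tail_ball_def)
    have "\<bar>coord t n\<bar> \<le> 1" for n
      using abs_coord_le_norm[of t n] t by (auto simp: tail_ball_def)
    then show "norm x \<le> 1" by (intro norm_c0_leI) (simp add: x)
    show "norm (t - x) \<le> e"
      using N e by (intro norm_c0_leI) (auto simp: x m_def less_imp_le)
  qed
qed

lemma disjoint_sum_tail:
  assumes "supp_in {k..<m} x" "norm x \<le> 1" "w \<in> tail_ball m" "k \<le> m"
  shows "x + w \<in> tail_ball k"
proof -
  have w: "supp_in {m..} w" "norm w \<le> 1" using assms(3) by (simp_all add: tail_ball_def)
  have "\<bar>coord (x + w) n\<bar> \<le> 1" for n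
  proof (cases "n < m")
    case True
    then have "coord w n = 0" using w(1) by (simp add: supp_in_def)
    then show ?thesis using abs_coord_le_norm[of x n] assms(2) by simp
  next
    case False
    then have "coord x n = 0" using assms(1) by (simp add: supp_in_def)
    then show ?thesis using abs_coord_le_norm[of w n] w(2) by simp
  qed
  then have "norm (x + w) \<le> 1" by (rule norm_c0_leI)
  moreover have "supp_in {k..} (x + w)" using assms(1,4) w(1) by (simp add: supp_in_def)
  ultimately show ?thesis by (simp add: tail_ball_def)
qed

lemma uminus_tail_ball: "t \<in> tail_ball k \<Longrightarrow> - t \<in> tail_ball k"
  by (simp add: tail_ball_def supp_in_def)

lemma tail_ball_mono: "k \<le> m \<Longrightarrow> tail_ball m \<subseteq> tail_ball k"
  by (auto simp: tail_ball_def supp_in_def)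

lemma zero_in_tail_ball: "0 \<in> tail_ball k"
  by (simp add: tail_ball_def supp_in_def)

section \<open>Asymptotically extremal blocks\<close>

text \<open>An isomorphic embedding of $c_0$. Only the constant \<open>A\<close> of the lower estimate is named: the
  upper constant of the embedding plays no role in the final estimates.\<close>
locale c0_embedding = bounded_linear J for J :: "c0 \<Rightarrow> 'a::real_normed_vector" +
  fixes A :: real
  assumes A_pos: "A > 0" and norm_below: "A * norm x \<le> norm (J x)"
begin

text \<open>The largest norm that \<open>v\<close> attains when perturbed by the image of the unit ball of a tail of
  $c_0$.\<close>
definition tail_sup :: "nat \<Rightarrow> 'a \<Rightarrow> real"
  where "tail_sup k v = (SUP t\<in>tail_ball k. norm (v + J t))"

text \<open>The limit of these suprema along the tails. Its value at $0$ is the norm that the unit ball of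
  $c_0$ retains arbitrarily far out; it replaces the constant $1$ of the original norm of $c_0$.\<close>
definition tail_limit :: "'a \<Rightarrow> real"
  where "tail_limit v = (INF k. tail_sup k v)"

lemma bdd_above_tail: "bdd_above ((\<lambda>t. norm (v + J t)) ` tail_ball k)"
proof -
  obtain B where B: "B > 0" "\<And>x. norm (J x) \<le> norm x * B" using pos_bounded by blast
  have "norm (v + J t) \<le> norm v + B" if "t \<in> tail_ball k" for t
  proof -
    have "norm t * B \<le> 1 * B"
      using that B(1) by (intro mult_right_mono) (auto simp: tail_ball_def)
    then show ?thesis using norm_triangle_ineq[of v "J t"] B(2)[of t] by linarith
  qed
  then show ?thesis by (rule bdd_aboveI2)
qed

lemma le_tail_sup: "t \<in> tail_ball k \<Longrightarrow> norm (v + J t) \<le> tail_sup k v"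
  unfolding tail_sup_def by (rule cSUP_upper[OF _ bdd_above_tail])

lemma tail_sup_nonneg: "0 \<le> tail_sup k v"
  using le_tail_sup[OF zero_in_tail_ball[of k], of v] norm_ge_zero[of "v + J 0"] by linarith

lemma tail_sup_antimono: "k \<le> m \<Longrightarrow> tail_sup m v \<le> tail_sup k v"
  unfolding tail_sup_def using zero_in_tail_ball[of m] tail_ball_mono[of k m]
  by (intro cSUP_subset_mono bdd_above_tail order_refl) blast+

lemma bdd_below_tail_sup: "bdd_below (range (\<lambda>k. tail_sup k v))"
  by (rule bdd_belowI2[of _ 0]) (rule tail_sup_nonneg)

lemma tail_limit_le: "tail_limit v \<le> tail_sup k v"
  unfolding tail_limit_def by (rule cINF_lower[OF bdd_below_tail_sup]) simp

lemma tail_sup_tendsto: "(\<lambda>k. tail_sup k v) \<longlonglongrightarrow> tail_limit v"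
  unfolding tail_limit_def
  by (rule LIMSEQ_decseq_INF[OF bdd_below_tail_sup]) (simp add: decseq_def tail_sup_antimono)

lemma tail_sup_zero_le: "tail_sup k 0 \<le> tail_sup k v"
  unfolding tail_sup_def[of k 0]
proof (rule cSUP_least)
  show "tail_ball k \<noteq> {}" using zero_in_tail_ball by blast
next
  fix t assume t: "t \<in> tail_ball k"
  have "(v + J t) - (v + J (- t)) = 2 *\<^sub>R J t" by (simp add: neg scaleR_2)
  then have "2 * norm (J t) \<le> norm (v + J t) + norm (v + J (- t))"
    using norm_triangle_ineq4[of "v + J t" "v + J (- t)"] by simp
  then show "norm (0 + J t) \<le> tail_sup k v"
    using le_tail_sup[OF t, of v] le_tail_sup[OF uminus_tail_ball[OF t], of v] by simp
qed

text \<open>This is why tails can absorb interference from earlier coordinates: by symmetry of the tail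
  balls, no vector \<open>v\<close> can shorten all far perturbations at the same time.\<close>
lemma tail_limit_zero_le: "tail_limit 0 \<le> tail_limit v"
  by (rule LIMSEQ_le[OF tail_sup_tendsto tail_sup_tendsto]) (use tail_sup_zero_le in blast)

lemma tail_limit_zero_pos: "tail_limit 0 > 0"
proof -
  have "A \<le> tail_sup k 0" for k
  proof -
    let ?x = "c0_unit k"
    have "norm ?x \<le> 1" by (rule norm_c0_leI) simp
    then have "?x \<in> tail_ball k" by (simp add: tail_ball_def supp_in_def)
    then have "norm (J ?x) \<le> tail_sup k 0" using le_tail_sup[of ?x k 0] by simp
    moreover have "norm ?x \<ge> 1" using abs_coord_le_norm[of ?x k] by simp
    then have "A * 1 \<le> A * norm ?x" using A_pos by (intro mult_left_mono) simp_all
    ultimately show ?thesis using norm_below[of ?x] by simp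
  qed
  then have "A \<le> tail_limit 0" unfolding tail_limit_def by (intro cINF_greatest) auto
  then show ?thesis using A_pos by simp
qed

lemma almost_maximal_block:
  assumes e: "e > 0"
  obtains m x where "m > k" "supp_in {k..<m} x" "norm x \<le> 1" "norm (v + J x) \<ge> tail_limit v - e"
proof -
  have "\<exists>t\<in>tail_ball k. tail_sup k v - e / 2 < norm (v + J t)"
    unfolding tail_sup_def using zero_in_tail_ball e bdd_above_tail
    by (subst less_cSUP_iff[symmetric]) auto
  then obtain t where t: "t \<in> tail_ball k" "tail_sup k v - e / 2 < norm (v + J t)" by blast
  obtain B where B: "B > 0" "\<And>x. norm (J x) \<le> norm x * B" using pos_bounded by blast
  have "e / (2 * B) > 0" using e B by simp
  from tail_ball_truncate[OF t(1) this] obtain m x where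
    x: "m > k" "supp_in {k..<m} x" "norm x \<le> 1" "norm (t - x) \<le> e / (2 * B)" by blast
  have "norm (J (t - x)) \<le> e / 2"
    using B(2)[of "t - x"] mult_right_mono[OF x(4), of B] B(1) by (simp add: field_simps)
  moreover have eq: "v + J t = (v + J x) + J (t - x)" by (simp add: diff)
  have "norm (v + J t) \<le> norm (v + J x) + norm (J (t - x))"
    unfolding eq by (rule norm_triangle_ineq)
  ultimately have "norm (v + J x) \<ge> tail_limit v - e" using t(2) tail_limit_le[of v k] by linarith
  with x show thesis by (intro that[of m x])
qed

text \<open>One block serves finitely many vectors at once: it is the sum of disjoint blocks, each almost
  maximal for one of them. The remaining blocks and any further tail vector do little harm, by
  averaging: if $v + J t$ is almost as long as the supremum permits and neither
  $v + J (t + u)$ nor $v + J (t - u)$ exceeds the supremum, then neither of the two is much shorter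
  than $v + J t$.\<close>
lemma finite_set_block:
  assumes "finite F" and e: "e > 0" and k: "\<And>v. v \<in> F \<Longrightarrow> tail_sup k v \<le> tail_limit v + e"
  shows "\<exists>m>k. \<exists>x. supp_in {k..<m} x \<and> norm x \<le> 1 \<and>
    (\<forall>v\<in>F. \<forall>w\<in>tail_ball m. norm (v + J (x + w)) \<ge> tail_limit v - 3 * e)"
  using assms(1) k
proof (induction F)
  case empty
  show ?case by (rule exI[of _ "Suc k"]) (auto intro!: exI[of _ 0] simp: supp_in_def)
next
  case (insert v F)
  then obtain m x where m: "m > k" and x: "supp_in {k..<m} x" "norm x \<le> 1"
    and IH: "\<And>v w. v \<in> F \<Longrightarrow> w \<in> tail_ball m \<Longrightarrow> norm (v + J (x + w)) \<ge> tail_limit v - 3 * e"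
    by auto
  obtain m' t where m': "m' > m" and t: "supp_in {m..<m'} t" "norm t \<le> 1"
    and vt: "norm (v + J t) \<ge> tail_limit v - e"
    using almost_maximal_block[OF e] by blast
  have tt: "t \<in> tail_ball m" using t by (auto simp: tail_ball_def supp_in_def)
  have sx: "supp_in {k..<m'} (x + t)"
    using x(1) t(1) m m' by (auto simp: supp_in_def)
  have nx: "norm (x + t) \<le> 1"
    using disjoint_sum_tail[OF x tt] m by (simp add: tail_ball_def)
  have "norm (u + J (x + t + w)) \<ge> tail_limit u - 3 * e"
    if u: "u \<in> insert v F" and w: "w \<in> tail_ball m'" for u w
  proof -
    have tw: "t + w \<in> tail_ball m" using disjoint_sum_tail[OF t w] m' by simp
    show ?thesis
    proof (cases "u = v")
      case False
      then show ?thesis using IH[OF _ tw, of u] u by (simp add: add.assoc)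
    next
      case True
      have "t - w \<in> tail_ball m"
        using disjoint_sum_tail[OF t uminus_tail_ball[OF w]] m' by simp
      moreover have "supp_in {k..<m} (- x)" "norm (- x) \<le> 1" using x by (auto simp: supp_in_def)
      ultimately have "- x + (t - w) \<in> tail_ball k"
        using disjoint_sum_tail m by (metis less_imp_le)
      then have up: "norm (v + J (- x + (t - w))) \<le> tail_limit v + e"
        using le_tail_sup insert.prems[of v] by (meson insertI1 order_trans)
      \<comment> \<open>the two perturbations are mirror images of each other about the maximal vector\<close>
      have eq: "(v + J (x + t + w)) + (v + J (- x + (t - w))) = 2 *\<^sub>R (v + J t)"
        by (simp add: add diff neg scaleR_2 algebra_simps)
      have "2 * norm (v + J t) \<le> norm (v + J (x + t + w)) + norm (v + J (- x + (t - w)))"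
        using norm_triangle_ineq[of "v + J (x + t + w)" "v + J (- x + (t - w))"]
        unfolding eq by simp
      then show ?thesis using up vt True by simp
    qed
  qed
  then show ?case using m m' sx nx by (intro exI[of _ m'] conjI exI[of _ "x + t"]) auto
qed

text \<open>Uniformity in \<open>v\<close>: vectors of norm at most $2$ on finitely many coordinates form a compact set, so
  a finite net suffices.\<close>
lemma asymptotically_extremal_block:
  assumes e: "e > 0"
  shows "\<exists>m>p. \<exists>x. supp_in {p..<m} x \<and> norm x \<le> 1 \<and>
    (\<forall>v w. supp_in {..<p} v \<longrightarrow> norm v \<le> 2 \<longrightarrow> w \<in> tail_ball m \<longrightarrow>
      norm (J (v + x + w)) \<ge> tail_limit 0 - e)"
proof -
  have e4: "e / 4 > 0" using e by simp
  obtain C where C: "compact C" "{v. supp_in {..<p} v \<and> norm v \<le> 2} \<subseteq> C"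
    using finite_block_compact[of p 2] by blast
  have cJ: "compact (J ` C)"
    using C(1) by (intro compact_continuous_image continuous_on continuous_on_id)
  have "\<exists>F. finite F \<and> F \<subseteq> J ` C \<and> J ` C \<subseteq> (\<Union>v\<in>F. ball v (e / 4))"
    using seq_compact_imp_totally_bounded[OF compact_imp_seq_compact[OF cJ], rule_format, OF e4] .
  then obtain F where F: "finite F" "J ` C \<subseteq> (\<Union>v\<in>F. ball v (e / 4))" by (elim exE conjE)
  have "\<forall>\<^sub>F k in sequentially. \<forall>v\<in>F. tail_sup k v < tail_limit v + e / 4"
    using F(1) e4 by (intro eventually_ball_finite ballI order_tendstoD(2)[OF tail_sup_tendsto]) auto
  then obtain N where N: "\<And>k v. k \<ge> N \<Longrightarrow> v \<in> F \<Longrightarrow> tail_sup k v < tail_limit v + e / 4"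
    unfolding eventually_sequentially by blast
  define k where "k = max p N"
  have k: "k \<ge> p" "\<And>v. v \<in> F \<Longrightarrow> tail_sup k v \<le> tail_limit v + e / 4"
    using N[of k] by (simp_all add: k_def less_imp_le)
  obtain m x where m: "m > k" and x: "supp_in {k..<m} x" "norm x \<le> 1"
    and low: "\<And>v w. v \<in> F \<Longrightarrow> w \<in> tail_ball m \<Longrightarrow>
      norm (v + J (x + w)) \<ge> tail_limit v - 3 * (e / 4)"
    using finite_set_block[OF F(1) e4 k(2)] by blast
  have "norm (J (v + x + w)) \<ge> tail_limit 0 - e"
    if v: "supp_in {..<p} v" "norm v \<le> 2" and w: "w \<in> tail_ball m" for v w
  proof -
    have "J v \<in> J ` C" using C(2) v by blast
    then have "J v \<in> (\<Union>u\<in>F. ball u (e / 4))" using F(2) by (rule rev_subsetD)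
    then obtain u where u: "u \<in> F" "dist u (J v) < e / 4" by auto
    have eq: "u + J (x + w) = (u - J v) + J (v + x + w)" by (simp add: add)
    have "norm (u + J (x + w)) \<le> norm (u - J v) + norm (J (v + x + w))"
      unfolding eq by (rule norm_triangle_ineq)
    then show ?thesis using low[OF u(1) w] u(2) tail_limit_zero_le[of u] by (simp add: dist_norm)
  qed
  moreover have "supp_in {p..<m} x" using x(1) k(1) by (auto simp: supp_in_def)
  moreover have "m > p" using m k(1) by simp
  ultimately show ?thesis using x(2) by blast
qed

section \<open>An embedding with asymptotically sharp estimates\<close>

lemma extremal_block_sequence:
  assumes e: "\<And>i. e i > (0::real)"
  obtains p :: "nat \<Rightarrow> nat" and z :: "nat \<Rightarrow> c0"
  where "p 0 = 0" "strict_mono p" "\<And>i. supp_in {p i..<p (Suc i)} (z i)" "\<And>i. norm (z i) \<le> 1"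
    "\<And>i v w. supp_in {..<p i} v \<Longrightarrow> norm v \<le> 2 \<Longrightarrow> w \<in> tail_ball (p (Suc i)) \<Longrightarrow>
      norm (J (v + z i + w)) \<ge> tail_limit 0 - e i"
proof -
  define P where "P i k m x \<longleftrightarrow> m > k \<and> supp_in {k..<m} x \<and> norm x \<le> 1 \<and>
    (\<forall>v w. supp_in {..<k} v \<longrightarrow> norm v \<le> 2 \<longrightarrow> w \<in> tail_ball m \<longrightarrow>
      norm (J (v + x + w)) \<ge> tail_limit 0 - e i)" for i k m x
  have ex: "\<exists>q. P i k (fst q) (snd q)" for i k
    using asymptotically_extremal_block[OF e[of i], of k] unfolding P_def by simp
  define q where "q i k = (SOME q. P i k (fst q) (snd q))" for i k
  have q: "P i k (fst (q i k)) (snd (q i k))" for i k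
    unfolding q_def by (rule someI_ex[OF ex])
  define p where "p = rec_nat 0 (\<lambda>i k. fst (q i k))"
  define z where "z i = snd (q i (p i))" for i
  have P: "P i (p i) (p (Suc i)) (z i)" for i
    using q[of i "p i"] by (simp add: p_def z_def)
  show thesis
  proof (rule that[of p z])
    show "p 0 = 0" by (simp add: p_def)
    show "strict_mono p" using P unfolding strict_mono_Suc_iff P_def by blast
  qed (use P in \<open>unfold P_def, blast+\<close>)
qed

text \<open>The blocks \<open>z i\<close>, multiplied by weights \<open>w i\<close> that decrease to $1/\rho$, span a copy of $c_0$ on
  which the norm dominates the supremum norm exactly, while on the tails the two norms agree up to
  factors tending to $1$. The weights have to decrease to a positive limit: a shift by
  $n$ blocks then costs a factor that tends to $1$ as $n$ grows, although the first blocks have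
  defects that are not small.\<close>
lemma block_embedding:
  obtains S :: "c0 \<Rightarrow> 'a" and \<beta> where "linear S" "\<And>d. norm d \<le> norm (S d)"
    "\<And>n d. supp_in {n..} d \<Longrightarrow> norm (S d) \<le> \<beta> n * norm d" "\<beta> \<longlonglongrightarrow> 1" "\<And>n. \<beta> n \<ge> 0"
proof -
  define \<rho> where "\<rho> = tail_limit 0"
  have \<rho>: "\<rho> > 0" using tail_limit_zero_pos by (simp add: \<rho>_def)
  define w where "w i = (1 + inverse (real (Suc i))) / \<rho>" for i
  have w_pos: "w i > 0" for i
    unfolding w_def using \<rho> by (intro divide_pos_pos add_pos_pos) simp_all
  have w_mono: "w j \<le> w i" if "i \<le> j" for i j
    unfolding w_def using \<rho> that
    by (intro divide_right_mono add_left_mono le_imp_inverse_le) simp_all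
  have w_low: "1 / \<rho> < w i" for i
    unfolding w_def using \<rho> by (intro divide_strict_right_mono) simp_all
  have w_2: "w j \<le> 2 * w i" for i j
  proof -
    have "w j \<le> w 0" by (rule w_mono) simp
    also have "\<dots> = 2 * (1 / \<rho>)" by (simp add: w_def)
    also have "\<dots> \<le> 2 * w i" using w_low[of i] by simp
    finally show ?thesis .
  qed
  \<comment> \<open>the defect allowed for block \<open>i\<close> is exactly what the weight compensates\<close>
  define e where "e i = \<rho> - 1 / w i" for i
  have e: "e i > 0" for i
  proof -
    have "1 / w i < 1 / (1 / \<rho>)"
      using w_low[of i] w_pos[of i] \<rho> by (intro divide_strict_left_mono) simp_all
    then show ?thesis by (simp add: e_def)
  qed
  obtain p z where p: "p 0 = 0" "strict_mono p"
    and z: "\<And>i. supp_in {p i..<p (Suc i)} (z i)" "\<And>i. norm (z i) \<le> 1"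
    and low: "\<And>i v u. supp_in {..<p i} v \<Longrightarrow> norm v \<le> 2 \<Longrightarrow> u \<in> tail_ball (p (Suc i)) \<Longrightarrow>
      norm (J (v + z i + u)) \<ge> tail_limit 0 - e i"
    using extremal_block_sequence[of e, OF e] by blast
  have p_ge: "n \<le> p n" for n using p(2) by (rule strict_mono_imp_increasing)
  \<comment> \<open>the number of the block that contains the index \<open>n\<close>\<close>
  define bl where "bl n = (LEAST i. n < p (Suc i))" for n
  have bl_less: "n < p (Suc (bl n))" for n
    unfolding bl_def by (rule LeastI[of _ n]) (use p_ge[of "Suc n"] in simp)
  have bl_iff: "bl n < i \<longleftrightarrow> n < p i" for n i
  proof
    assume "bl n < i"
    then have "p (Suc (bl n)) \<le> p i" using strict_mono_less_eq[OF p(2)] by simp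
    then show "n < p i" using bl_less[of n] by simp
  next
    assume n: "n < p i"
    then obtain j where j: "i = Suc j" using p(1) by (cases i) auto
    have "bl n \<le> j" unfolding bl_def using n j by (intro Least_le) simp
    then show "bl n < i" using j by simp
  qed
  have bl_lim: "filterlim bl at_top sequentially"
    unfolding filterlim_at_top
  proof
    fix i
    show "\<forall>\<^sub>F n in sequentially. i \<le> bl n"
      by (rule eventually_sequentiallyI[of "p i"]) (use bl_iff in \<open>simp add: not_less[symmetric]\<close>)
  qed
  have z_le: "\<bar>coord (z i) n\<bar> \<le> 1" for i n
    using abs_coord_le_norm[of "z i" n] z(2)[of i] by linarith
  define g where "g d n = w (bl n) * coord (z (bl n)) n * coord d (bl n)" for d n
  have g_le: "\<bar>g d n\<bar> \<le> w (bl n) * \<bar>coord d (bl n)\<bar>" for d n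
  proof -
    have "\<bar>g d n\<bar> = w (bl n) * \<bar>coord (z (bl n)) n\<bar> * \<bar>coord d (bl n)\<bar>"
      using w_pos[of "bl n"] by (simp add: g_def abs_mult)
    also have "\<dots> \<le> w (bl n) * 1 * \<bar>coord d (bl n)\<bar>"
      using w_pos[of "bl n"] z_le by (intro mult_right_mono mult_left_mono) simp_all
    finally show ?thesis by simp
  qed
  have g_lim: "g d \<longlonglongrightarrow> 0" for d
  proof (rule Lim_null_comparison)
    have "norm (g d n) \<le> w 0 * \<bar>coord d (bl n)\<bar>" for n
      using g_le[of d n] mult_right_mono[OF w_mono[of 0 "bl n"], of "\<bar>coord d (bl n)\<bar>"] by simp
    then show "\<forall>\<^sub>F n in sequentially. norm (g d n) \<le> w 0 * \<bar>coord d (bl n)\<bar>" by simp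
    have "(\<lambda>n. coord d (bl n)) \<longlonglongrightarrow> 0"
      by (rule filterlim_compose[OF c0_seq_tendsto bl_lim])
    then show "(\<lambda>n. w 0 * \<bar>coord d (bl n)\<bar>) \<longlonglongrightarrow> 0"
      by (intro tendsto_mult_right_zero tendsto_rabs_zero)
  qed
  define U where "U d = c0_of (g d)" for d
  have U: "coord (U d) n = g d n" for d n unfolding U_def by (rule coord_c0_of[OF g_lim])
  \<comment> \<open>\<open>U d\<close> is the block sum with coefficients \<open>w i * d i\<close>\<close>
  define S where "S d = J (U d)" for d
  define \<beta> where "\<beta> n = w n * tail_sup n 0" for n
  have "linear U"
    by (rule linearI; rule c0_eqI) (simp_all add: U g_def algebra_simps)
  then have "linear S"
    unfolding S_def using linear_compose[OF _ linear, of U] by (simp add: o_def)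
  moreover have "norm d \<le> norm (S d)" for d
  proof -
    obtain i where i: "norm d = \<bar>coord d i\<bar>" by (rule norm_c0_attained)
    show ?thesis
    proof (cases "coord d i = 0")
      case True
      then show ?thesis using i by simp
    next
      case False
      \<comment> \<open>normalise at a coordinate of maximal modulus: block \<open>i\<close> then appears with coefficient $1$,
        earlier blocks with coefficients at most $2$ and later ones with coefficients at most $1$\<close>
      define c where "c = w i * coord d i"
      have c: "c \<noteq> 0" using False w_pos[of i] by (simp add: c_def)
      define y where "y = (1 / c) *\<^sub>R U d"
      have y_le: "\<bar>coord y n\<bar> \<le> w (bl n) / w i" for n
      proof -
        have "\<bar>coord d (bl n)\<bar> \<le> \<bar>coord d i\<bar>" using abs_coord_le_norm[of d "bl n"] i by simp
        then have "w (bl n) * \<bar>coord d (bl n)\<bar> \<le> w (bl n) * \<bar>coord d i\<bar>"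
          using w_pos[of "bl n"] by (intro mult_left_mono) simp_all
        then have "\<bar>g d n\<bar> \<le> w (bl n) * \<bar>coord d i\<bar>" using g_le[of d n] by linarith
        then have "\<bar>g d n\<bar> / (w i * \<bar>coord d i\<bar>) \<le> w (bl n) * \<bar>coord d i\<bar> / (w i * \<bar>coord d i\<bar>)"
          using w_pos[of i] by (intro divide_right_mono) simp_all
        then show ?thesis
          using False w_pos[of i] by (simp add: y_def U c_def abs_mult)
      qed
      define v where "v = c0_restrict {..<p i} y"
      define u where "u = c0_restrict {p (Suc i)..} y"
      have "y = v + z i + u"
      proof (rule c0_eqI)
        fix n
        consider "n < p i" | "p i \<le> n" "n < p (Suc i)" | "p (Suc i) \<le> n" by linarith
        then show "coord y n = coord (v + z i + u) n"
        proof cases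
          case 1
          then have "n < p (Suc i)" using p(2) by (metis less_trans strict_mono_Suc_iff)
          moreover have "coord (z i) n = 0" using z(1)[of i] 1 by (simp add: supp_in_def)
          ultimately show ?thesis using 1 by (simp add: v_def u_def)
        next
          case 2
          then have "bl n = i" using bl_iff[of n i] bl_iff[of n "Suc i"] by simp
          then have "coord y n = coord (z i) n"
            using c False w_pos[of i] by (simp add: y_def U g_def c_def)
          then show ?thesis using 2 by (simp add: v_def u_def)
        next
          case 3
          then have "p i \<le> n" using p(2) by (metis le_trans less_imp_le strict_mono_Suc_iff)
          moreover have "coord (z i) n = 0" using z(1)[of i] 3 by (simp add: supp_in_def)
          ultimately show ?thesis using 3 by (simp add: v_def u_def)
        qed
      qed
      moreover have "supp_in {..<p i} v" by (simp add: supp_in_def v_def)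
      moreover have "norm v \<le> 2"
      proof (rule norm_c0_leI)
        fix n
        have "\<bar>coord y n\<bar> \<le> 2"
          using y_le[of n] w_2[of "bl n" i] w_pos[of i] by (simp add: divide_le_eq order_trans)
        then show "\<bar>coord v n\<bar> \<le> 2" by (simp add: v_def)
      qed
      moreover have "u \<in> tail_ball (p (Suc i))"
      proof -
        have "\<bar>coord u n\<bar> \<le> 1" for n
        proof (cases "p (Suc i) \<le> n")
          case True
          then have "i \<le> bl n" using bl_iff[of n "Suc i"] by linarith
          then have "w (bl n) / w i \<le> 1" using w_mono w_pos[of i] by simp
          then show ?thesis using y_le[of n] True by (simp add: u_def)
        qed (simp add: u_def)
        then have "norm u \<le> 1" by (rule norm_c0_leI)
        then show ?thesis by (simp add: tail_ball_def supp_in_def u_def)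
      qed
      ultimately have "1 / w i \<le> norm (J y)" using low[of i v u] by (simp add: e_def \<rho>_def)
      then have "\<bar>c\<bar> * (1 / w i) \<le> \<bar>c\<bar> * norm (J y)" by (rule mult_left_mono) simp
      moreover have "\<bar>c\<bar> * (1 / w i) = \<bar>coord d i\<bar>"
        using w_pos[of i] by (simp add: c_def abs_mult)
      moreover have "S d = c *\<^sub>R J y" using c by (simp add: S_def y_def scaleR)
      ultimately show ?thesis using i by simp
    qed
  qed
  moreover have "norm (S d) \<le> \<beta> n * norm d" if d: "supp_in {n..} d" for n d
  proof (cases "d = 0")
    case True
    then show ?thesis using linear_0[OF \<open>linear S\<close>] by simp
  next
    case False
    define c where "c = w n * norm d"
    have c: "c > 0" using False w_pos[of n] by (simp add: c_def)
    define t where "t = (1 / c) *\<^sub>R U d"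
    have coord_t: "coord t k = g d k / c" for k by (simp add: t_def U)
    have "supp_in {n..} t"
      unfolding supp_in_def
    proof (intro allI impI)
      fix k assume "k \<notin> {n..}"
      then have "k < p n" using p_ge[of n] by simp
      then have "bl k < n" by (simp add: bl_iff)
      then have "coord d (bl k) = 0" using d by (simp add: supp_in_def)
      then show "coord t k = 0" by (simp add: coord_t g_def)
    qed
    moreover have "norm t \<le> 1"
    proof (rule norm_c0_leI)
      fix k
      have "w (bl k) * \<bar>coord d (bl k)\<bar> \<le> c"
      proof (cases "n \<le> bl k")
        case True
        then show ?thesis
          unfolding c_def using w_mono abs_coord_le_norm w_pos[of n] by (intro mult_mono) simp_all
      next
        case False
        then have "coord d (bl k) = 0" using d by (simp add: supp_in_def)
        then show ?thesis using c by simp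
      qed
      then have "\<bar>g d k\<bar> \<le> c" using g_le[of d k] by linarith
      then show "\<bar>coord t k\<bar> \<le> 1" using c by (simp add: coord_t)
    qed
    ultimately have "t \<in> tail_ball n" by (simp add: tail_ball_def)
    then have "norm (J t) \<le> tail_sup n 0" using le_tail_sup[of t n 0] by simp
    then have "c * norm (J t) \<le> c * tail_sup n 0" using c by (intro mult_left_mono) simp_all
    moreover have "S d = c *\<^sub>R J t" using c by (simp add: S_def t_def scaleR)
    ultimately show ?thesis using c by (simp add: \<beta>_def c_def mult_ac)
  qed
  moreover have "\<beta> \<longlonglongrightarrow> 1"
  proof -
    have "w \<longlonglongrightarrow> (1 + 0) / \<rho>"
      unfolding w_def using \<rho> by (intro tendsto_intros LIMSEQ_inverse_real_of_nat) simp
    then have "\<beta> \<longlonglongrightarrow> (1 + 0) / \<rho> * \<rho>"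
      unfolding \<beta>_def \<rho>_def by (intro tendsto_mult tail_sup_tendsto)
    then show ?thesis using \<rho> by simp
  qed
  moreover have "\<beta> n \<ge> 0" for n
    using w_pos[of n] tail_sup_nonneg[of n 0] by (simp add: \<beta>_def)
  ultimately show thesis by (rule that)
qed

end

section \<open>The shift on an embedded cube\<close>

text \<open>The affine right shift $(x_0, x_1, \ldots) \mapsto (1, x_0, x_1, \ldots)$. A fixed point would be the
  constant sequence $1$, which is not a null sequence.\<close>
definition c0_shift :: "c0 \<Rightarrow> c0"
  where "c0_shift x = c0_of (\<lambda>n. case n of 0 \<Rightarrow> 1 | Suc m \<Rightarrow> coord x m)"

lemma coord_c0_shift: "coord (c0_shift x) n = (case n of 0 \<Rightarrow> 1 | Suc m \<Rightarrow> coord x m)"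
proof -
  have "(\<lambda>n. case n of 0 \<Rightarrow> 1 | Suc m \<Rightarrow> coord x m) \<longlonglongrightarrow> 0"
    by (rule LIMSEQ_imp_Suc) (simp add: c0_seq_tendsto)
  then show ?thesis by (simp add: c0_shift_def)
qed

lemma coord_c0_shift_power_diff:
  "coord ((c0_shift ^^ n) x) k - coord ((c0_shift ^^ n) y) k =
    (if k < n then 0 else coord x (k - n) - coord y (k - n))"
proof (induction n arbitrary: k)
  case 0
  show ?case by simp
next
  case (Suc n)
  then show ?case by (cases k) (simp_all add: coord_c0_shift)
qed

lemma c0_shift_neq: "c0_shift x \<noteq> x"
proof
  assume eq: "c0_shift x = x"
  have "coord x n = 1" for n
  proof (induction n)
    case 0
    show ?case using coord_c0_shift[of x 0] by (simp add: eq)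
  next
    case (Suc n)
    then show ?case using coord_c0_shift[of x "Suc n"] by (simp add: eq)
  qed
  then have "apply_bcontfun (c0_seq x) = (\<lambda>_. 1)" by (rule ext)
  then have "(\<lambda>_::nat. 1::real) \<longlonglongrightarrow> 0" using c0_seq_tendsto[of x] by simp
  then show False by (simp add: LIMSEQ_const_iff)
qed

text \<open>The null sequences with all coordinates in $[0,1]$.\<close>
definition c0_cube :: "c0 set"
  where "c0_cube = {x. \<forall>n. coord x n \<in> {0..1}}"

lemma c0_shift_cube: "x \<in> c0_cube \<Longrightarrow> c0_shift x \<in> c0_cube"
  by (auto simp: c0_cube_def coord_c0_shift split: nat.split)

lemma bounded_linear_coord: "bounded_linear (\<lambda>x. coord x n)"
proof (rule bounded_linear_intro[of _ 1])
  show "norm (coord x n) \<le> norm x * 1" for x using abs_coord_le_norm[of x n] by simp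
qed simp_all

lemma closed_c0_cube: "closed c0_cube"
proof -
  have eq: "c0_cube = (\<Inter>n. (\<lambda>x. coord x n) -` {0..1})"
    by (auto simp: c0_cube_def)
  have "closed ((\<lambda>x. coord x n) -` {0..1})" for n
    by (intro closed_vimage closed_atLeastAtMost linear_continuous_on[OF bounded_linear_coord])
  then show ?thesis unfolding eq by (intro closed_INT) simp
qed

lemma convex_c0_cube: "convex c0_cube"
proof (rule convexI)
  fix x y :: c0 and u v :: real
  assume x: "x \<in> c0_cube" and y: "y \<in> c0_cube" and uv: "0 \<le> u" "0 \<le> v" "u + v = 1"
  have "coord (u *\<^sub>R x + v *\<^sub>R y) n \<in> {0..1}" for n
  proof -
    have "coord x n \<in> {0..1}" "coord y n \<in> {0..1}" using x y by (simp_all add: c0_cube_def)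
    then have "u *\<^sub>R coord x n + v *\<^sub>R coord y n \<in> {0..1}"
      using uv by (intro convexD[OF convex_real_interval(5)])
    then show ?thesis by simp
  qed
  then show "u *\<^sub>R x + v *\<^sub>R y \<in> c0_cube" by (simp add: c0_cube_def)
qed

lemma closed_image_bounded_below:
  fixes S :: "'a::banach \<Rightarrow> 'b::real_normed_vector"
  assumes "bounded_linear S" and A: "A > 0" and below: "\<And>x. A * norm x \<le> norm (S x)"
    and C: "closed C"
  shows "closed (S ` C)"
  unfolding closed_sequential_limits
proof (intro allI impI)
  interpret bounded_linear S by fact
  fix x l
  assume asm: "(\<forall>n. x n \<in> S ` C) \<and> x \<longlonglongrightarrow> l"
  then have l: "x \<longlonglongrightarrow> l" and "\<forall>n. \<exists>y. y \<in> C \<and> x n = S y" by auto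
  then obtain c where c: "\<And>n. c n \<in> C" "\<And>n. x n = S (c n)"
    using choice[of "\<lambda>n y. y \<in> C \<and> x n = S y"] by blast
  then have x: "x = (\<lambda>n. S (c n))" by (intro ext)
  have "Cauchy (\<lambda>n. S (c n))"
    using LIMSEQ_imp_Cauchy[OF l] unfolding x .
  then have "Cauchy c"
    using cauchy_isometric[OF A subspace_UNIV \<open>bounded_linear S\<close>, of c]
    by (simp add: below o_def)
  then obtain d where d: "c \<longlonglongrightarrow> d"
    using Cauchy_convergent_iff[of c] unfolding convergent_def by blast
  have "x \<longlonglongrightarrow> S d"
    using tendsto[OF d] unfolding x .
  then have "l = S d" by (rule LIMSEQ_unique[OF l])
  moreover have "d \<in> C" by (rule closed_sequentially[OF C c(1) d])
  ultimately show "l \<in> S ` C" by simp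
qed

lemma shift_on_embedded_cube:
  fixes S :: "c0 \<Rightarrow> 'a::real_normed_vector"
  assumes S: "linear S" and lower: "\<And>d. norm d \<le> norm (S d)"
    and upper: "\<And>n d. supp_in {n..} d \<Longrightarrow> norm (S d) \<le> \<beta> n * norm d"
    and \<beta>: "\<And>n. \<beta> n \<ge> 0"
  obtains K :: "'a::real_normed_vector set" and T where "K \<noteq> {}" "bounded K" "closed K" "convex K"
    "T \<in> K \<rightarrow> K"
    "fixed_point_free_on K T"
    "\<And>n x y. x \<in> K \<Longrightarrow> y \<in> K \<Longrightarrow> norm ((T ^^ n) x - (T ^^ n) y) \<le> \<beta> n * norm (x - y)"
proof -
  define K where "K = S ` c0_cube"
  define T where "T = (\<lambda>x. S (c0_shift (inv S x)))"
  have bd: "norm (S d) \<le> \<beta> 0 * norm d" for d by (rule upper) (simp add: supp_in_def)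
  have bl: "bounded_linear S"
    using S bd by (intro bounded_linear.intro bounded_linear_axioms.intro exI[of _ "\<beta> 0"])
      (auto simp: mult.commute)
  have "inj S"
  proof (rule injI)
    fix x y assume "S x = S y"
    then have "norm (x - y) \<le> 0" using lower[of "x - y"] by (simp add: linear_diff[OF S])
    then show "x = y" by simp
  qed
  then have T: "T (S x) = S (c0_shift x)" for x by (simp add: T_def)
  have T_power: "(T ^^ n) (S x) = S ((c0_shift ^^ n) x)" for n x
    by (induction n) (simp_all add: T)
  have cube_norm: "norm d \<le> 1" if "d \<in> c0_cube" for d
    using that by (intro norm_c0_leI) (simp add: c0_cube_def)
  show thesis
  proof (rule that[of K T])
    have "0 \<in> c0_cube" by (simp add: c0_cube_def)
    then show "K \<noteq> {}" by (auto simp: K_def)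
    have "bounded c0_cube" using cube_norm by (intro boundedI)
    then show "bounded K" unfolding K_def using bl by (rule bounded_linear_image)
    show "closed K"
      unfolding K_def using lower
      by (intro closed_image_bounded_below[OF bl zero_less_one _ closed_c0_cube]) simp
    show "convex K" unfolding K_def using S convex_c0_cube by (rule convex_linear_image)
    show "T \<in> K \<rightarrow> K" by (auto simp: K_def T intro: c0_shift_cube)
    show "fixed_point_free_on K T"
      using c0_shift_neq \<open>inj S\<close> by (auto simp: fixed_point_free_on_def K_def T inj_eq)
    fix n x y assume "x \<in> K" "y \<in> K"
    then obtain c d where xy: "x = S c" "y = S d" by (auto simp: K_def)
    let ?D = "(c0_shift ^^ n) c - (c0_shift ^^ n) d"
    have D: "coord ?D k = (if k < n then 0 else coord (c - d) (k - n))" for k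
      using coord_c0_shift_power_diff[of n c k d] by simp
    have "supp_in {n..} ?D" unfolding supp_in_def D by simp
    then have up: "norm (S ?D) \<le> \<beta> n * norm ?D" by (rule upper)
    have "norm ?D \<le> norm (c - d)"
    proof (rule norm_c0_leI)
      show "\<bar>coord ?D k\<bar> \<le> norm (c - d)" for k
        unfolding D using abs_coord_le_norm[of "c - d" "k - n"] norm_ge_zero[of "c - d"] by auto
    qed
    also have "\<dots> \<le> norm (x - y)" using lower[of "c - d"] by (simp add: xy linear_diff[OF S])
    finally have le: "norm ?D \<le> norm (x - y)" .
    have "\<beta> n * norm ?D \<le> \<beta> n * norm (x - y)" using le \<beta> by (rule mult_left_mono)
    with up show "norm ((T ^^ n) x - (T ^^ n) y) \<le> \<beta> n * norm (x - y)"
      by (simp add: xy T_power linear_diff[OF S])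
  qed
qed

section \<open>From Lipschitz to Hoelder estimates\<close>

text \<open>On a set of diameter at most \<open>D\<close> one has $r \le D^{1-\alpha} r^{\alpha}$ for all distances $r$, so
  Lipschitz constants tending to $1$ are also Hoelder constants tending to $1$.\<close>
lemma asymptotically_Holder_nonexpansiveI:
  fixes K :: "'a::real_normed_vector set"
  assumes K: "bounded K" "T \<in> K \<rightarrow> K"
    and Lip: "\<And>n x y. x \<in> K \<Longrightarrow> y \<in> K \<Longrightarrow>
      norm ((T ^^ n) x - (T ^^ n) y) \<le> \<beta> n * norm (x - y)"
    and \<beta>: "\<beta> \<longlonglongrightarrow> 1"
    and \<alpha>: "\<And>n. n \<ge> 1 \<Longrightarrow> \<alpha> n \<le> 1" "\<alpha> \<longlonglongrightarrow> 1"
  shows "asymptotically_Holder_nonexpansive \<alpha> K T"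
proof -
  obtain M where M: "M > 0" "\<And>x. x \<in> K \<Longrightarrow> norm x \<le> M"
    using K(1) bounded_pos by blast
  \<comment> \<open>\<open>D \<ge> 1\<close> bounds the diameter of \<open>K\<close>\<close>
  define D where "D = max 1 (2 * M)"
  define \<epsilon> where "\<epsilon> n = max 0 (\<bar>\<beta> n\<bar> * D powr (1 - \<alpha> n) - 1)" for n
  have D: "D \<ge> 1" "D > 0" by (simp_all add: D_def)
  have lim: "(\<lambda>n. D powr (1 - \<alpha> n)) \<longlonglongrightarrow> D powr (1 - 1)"
    using D by (intro tendsto_intros \<alpha>(2)) auto
  have "\<epsilon> \<longlonglongrightarrow> max 0 (\<bar>1\<bar> * D powr (1 - 1) - 1)"
    unfolding \<epsilon>_def
    by (intro tendsto_max tendsto_diff tendsto_mult tendsto_rabs tendsto_const \<beta> lim)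
  then have eps: "\<epsilon> \<longlonglongrightarrow> 0" using D by simp
  have "norm ((T ^^ n) x - (T ^^ n) y) \<le> (1 + \<epsilon> n) * norm (x - y) powr \<alpha> n"
    if "x \<in> K" "y \<in> K" "n \<ge> 1" for x y n
  proof -
    let ?r = "norm (x - y)"
    have "?r \<le> norm x + norm y" by (rule norm_triangle_ineq4)
    also have "\<dots> \<le> D" using M(2)[OF that(1)] M(2)[OF that(2)] by (simp add: D_def)
    finally have rD: "?r \<le> D" .
    have "?r = ?r powr (1 - \<alpha> n) * ?r powr \<alpha> n"
      by (simp add: powr_add[symmetric])
    also have "\<dots> \<le> D powr (1 - \<alpha> n) * ?r powr \<alpha> n"
      using rD \<alpha>(1)[OF that(3)] by (intro mult_right_mono powr_mono2) auto
    finally have r: "?r \<le> D powr (1 - \<alpha> n) * ?r powr \<alpha> n" .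
    have "norm ((T ^^ n) x - (T ^^ n) y) \<le> \<bar>\<beta> n\<bar> * ?r"
      using Lip[OF that(1,2), of n] mult_right_mono[OF abs_ge_self[of "\<beta> n"], of ?r] by simp
    also have "\<dots> \<le> \<bar>\<beta> n\<bar> * (D powr (1 - \<alpha> n) * ?r powr \<alpha> n)"
      using r by (intro mult_left_mono) auto
    also have "\<dots> = (\<bar>\<beta> n\<bar> * D powr (1 - \<alpha> n)) * ?r powr \<alpha> n" by (simp add: mult.assoc)
    also have "\<dots> \<le> (1 + \<epsilon> n) * ?r powr \<alpha> n"
      by (intro mult_right_mono) (auto simp: \<epsilon>_def)
    finally show ?thesis .
  qed
  moreover have "\<forall>n\<ge>1. 0 \<le> \<epsilon> n" by (simp add: \<epsilon>_def)
  ultimately show ?thesis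
    unfolding asymptotically_Holder_nonexpansive_def using K(2) eps by blast
qed

theorem theorem3p5:
  assumes "contains_isomorphic_copy_of_c0 TYPE('a::banach)"
  shows "\<exists>K :: 'a set. K \<noteq> {} \<and> bounded K \<and> closed K \<and> convex K \<and>
    (\<forall>\<alpha> :: nat \<Rightarrow> real.
      mono_on {1..} \<alpha> \<longrightarrow> (\<forall>n\<ge>1. \<alpha> n \<in> {0<..1}) \<longrightarrow> \<alpha> \<longlonglongrightarrow> 1 \<longrightarrow>
      (\<exists>T. asymptotically_Holder_nonexpansive \<alpha> K T \<and> fixed_point_free_on K T))"
proof (rule c0_copy_bounds[OF assms])
  fix J :: "c0 \<Rightarrow> 'a" and A
  assume J: "bounded_linear J" "A > 0" "\<And>x. A * norm x \<le> norm (J x)"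
  interpret c0_embedding J A
    using J by (intro c0_embedding.intro c0_embedding_axioms.intro)
  show ?thesis
  proof (rule block_embedding)
    fix S :: "c0 \<Rightarrow> 'a" and \<beta>
    assume S: "linear S" "\<And>d. norm d \<le> norm (S d)"
      "\<And>n d. supp_in {n..} d \<Longrightarrow> norm (S d) \<le> \<beta> n * norm d"
      and \<beta>: "\<beta> \<longlonglongrightarrow> 1" "\<And>n. \<beta> n \<ge> 0"
    show ?thesis
    proof (rule shift_on_embedded_cube[OF S \<beta>(2)])
      fix K :: "'a set" and T
      assume K: "K \<noteq> {}" "bounded K" "closed K" "convex K"
        and T: "T \<in> K \<rightarrow> K" "fixed_point_free_on K T"
        and Lip: "\<And>n x y. x \<in> K \<Longrightarrow> y \<in> K \<Longrightarrow>
          norm ((T ^^ n) x - (T ^^ n) y) \<le> \<beta> n * norm (x - y)"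
      have ex: "\<exists>T. asymptotically_Holder_nonexpansive \<alpha> K T \<and> fixed_point_free_on K T"
        if \<alpha>: "\<forall>n\<ge>1. \<alpha> n \<in> {0<..1}" "\<alpha> \<longlonglongrightarrow> 1" for \<alpha>
      proof (intro exI conjI)
        have le: "\<alpha> n \<le> 1" if "n \<ge> 1" for n using \<alpha>(1) that by simp
        show "asymptotically_Holder_nonexpansive \<alpha> K T"
          by (rule asymptotically_Holder_nonexpansiveI[OF K(2) T(1) Lip \<beta>(1) le \<alpha>(2)])
        show "fixed_point_free_on K T" by (rule T(2))
      qed
      show ?thesis by (intro exI[of _ K] conjI K; intro allI impI; rule ex)
    qed
  qed
qed

end
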